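(* Let $\Delta$ be a finite, nontrivial, and strongly connected multidigraph with vertex set $V_\Delta$. Then the following two conditions are equivalent: (1) $\Delta$ is path-Eulerian but is not circuit-Eulerian. (2) There are two vertices $b\neq e$ in $V_\Delta$ such that $\tau_\Delta(b)-\eta_\Delta(b)=1=\eta_\Delta(e)-\tau_\Delta(e)$, and $\tau_\Delta(x)=\eta_\Delta(x)$ for all vertices $x\in V_\Delta\setminus\{b,e\}$.
   Context: A multidigraph (directed multigraph) $\Delta$ consists of a nonempty set $V_\Delta$ of vertices and a family of directed edges (diedges), each having a tailpoint $x\in V_\Delta$ and a headpoint $y\in V_\Delta$, written $x\rightarrow y$. Several distinct diedges may have the same tailpoint and headpoint, and loops $x\rightarrow x$ are allowed. $\Delta$ is finite if it has finitely many vertices and diedges, and nontrivial if it has at least one diedge. The out-degree $\tau_\Delta(x)$ is the number of diedges of $\Delta$ with tailpoint $x$, and the in-degree $\eta_\Delta(x)$ is the number of diedges of $\Delta$ with headpoint $x$ (so a loop at $x$ contributes one to each). A dipath is a directed walk $x_0\rightarrow x_1\rightarrow\cdots\rightarrow x_n$ formed by successive diedges of $\Delta$ (vertices and diedges may be repeated). A dicircuit is such a directed walk with $n\ge 1$ and $x_n=x_0$. An Eulerian dipath (respectively Eulerian dicircuit) of $\Delta$ is a dipath (respectively dicircuit) in which each diedge of $\Delta$ occurs exactly once. $\Delta$ is circuit-Eulerian if it has an Eulerian dicircuit. $\Delta$ is path-Eulerian if it has an Eulerian dipath whose beginning vertex $b$ and end vertex $e$ are distinct. $\Delta$ is strongly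 connected if every two distinct vertices of $\Delta$ occur in a common dicircuit of $\Delta$. *)

theory Defs
  imports "Graph_Theory.Graph_Theory"
begin

text \<open>
  Multidigraphs are the digraphs of \<^locale>\<open>wf_digraph\<close>: arcs are objects of their own, so parallel
  arcs and loops are allowed. Directed walks are lists of arcs, see \<^const>\<open>pre_digraph.awalk\<close>.
\<close>

context pre_digraph
begin

definition dicircuit :: "'a \<Rightarrow> 'b awalk \<Rightarrow> bool" where
  "dicircuit u p \<longleftrightarrow> awalk u p u \<and> p \<noteq> []"

text \<open>
  The constant \<^const>\<open>euler_trail\<close> is not used below because it also requires that every vertex is
  visited. In \<^const>\<open>trail\<close> no arc is repeated, so \<open>trail u p v \<and> set p = arcs G\<close> says that
  each arc occurs exactly once.
\<close>

definition eulerian_dipath :: "'a \<Rightarrow> 'b awalk \<Rightarrow> 'a \<Rightarrow> bool" where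
  "eulerian_dipath u p v \<longleftrightarrow> trail u p v \<and> set p = arcs G"

definition eulerian_dicircuit :: "'a \<Rightarrow> 'b awalk \<Rightarrow> bool" where
  "eulerian_dicircuit u p \<longleftrightarrow> dicircuit u p \<and> distinct p \<and> set p = arcs G"

definition circuit_eulerian :: bool where
  "circuit_eulerian \<longleftrightarrow> (\<exists>u p. eulerian_dicircuit u p)"

definition path_eulerian :: bool where
  "path_eulerian \<longleftrightarrow> (\<exists>b p e. eulerian_dipath b p e \<and> b \<noteq> e)"

text \<open>
  Strong connectivity by common closed walks. For nonempty digraphs it agrees with the library's
  \<^const>\<open>strongly_connected\<close>, which is defined by reachability; see
  \<open>strongly_connected_iff_dicircuit_connected\<close>.
\<close>

definition dicircuit_connected :: bool where
  "dicircuit_connected \<longleftrightarrow>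
    (\<forall>x \<in> verts G. \<forall>y \<in> verts G. x \<noteq> y \<longrightarrow>
      (\<exists>u p. dicircuit u p \<and> x \<in> set (awalk_verts u p) \<and> y \<in> set (awalk_verts u p)))"

end

lemma (in wf_digraph) strongly_connected_iff_dicircuit_connected:
  "strongly_connected G \<longleftrightarrow> verts G \<noteq> {} \<and> dicircuit_connected"
proof (intro iffI conjI)
  assume sc: "strongly_connected G"
  then show "verts G \<noteq> {}" by (simp add: strongly_connected_def)
  show dicircuit_connected
    unfolding dicircuit_connected_def
  proof (intro ballI impI)
    fix x y assume "x \<in> verts G" "y \<in> verts G" "x \<noteq> y"
    with sc obtain p q where pq: "awalk x p y" "awalk y q x"
      unfolding strongly_connected_def reachable_awalk by blast
    with \<open>x \<noteq> y\<close> have "dicircuit x (p @ q)"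
      by (auto simp: dicircuit_def)
    moreover have "x \<in> set (awalk_verts x (p @ q))" "y \<in> set (awalk_verts x (p @ q))"
      using pq by (auto simp: set_awalk_verts_append)
    ultimately show "\<exists>u p. dicircuit u p \<and> x \<in> set (awalk_verts u p) \<and> y \<in> set (awalk_verts u p)"
      by blast
  qed
next
  assume *: "verts G \<noteq> {} \<and> dicircuit_connected"
  show "strongly_connected G"
    unfolding strongly_connected_def
  proof (intro conjI ballI)
    fix x y assume xy: "x \<in> verts G" "y \<in> verts G"
    show "x \<rightarrow>\<^sup>*\<^bsub>G\<^esub> y"
    proof (cases "x = y")
      case True
      with xy show ?thesis by simp
    next
      case False
      with * xy obtain u p where "awalk u p u"
        "x \<in> set (awalk_verts u p)" "y \<in> set (awalk_verts u p)"
        unfolding dicircuit_connected_def dicircuit_def by blast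
      then obtain r where "awalk x r x" "y \<in> set (awalk_verts x r)"
        by (metis rotate_awalkE)
      then show ?thesis
        using awalk_decomp reachable_awalk by blast
    qed
  qed (use * in simp)
qed

end

theory Submission
  imports Defs
begin

text \<open>
  Strong connectivity makes the underlying undirected graph connected. In a connected digraph a trail through all arcs visits all vertices, so Eulerian
  dipaths and dicircuits are exactly the open and closed Euler trails of the library, and its two
  Euler theorems describe their existence by degrees. In particular an Eulerian dipath from \<open>b\<close> to
  \<open>e \<noteq> b\<close> forces the degree condition in (2): along the walk every vertex is left as often as it is
  entered, except that \<open>b\<close> is left once more and \<open>e\<close> is entered once more. Conversely (2) produces
  such a dipath. It also excludes an Eulerian dicircuit, because that would balance in-degree and
  out-degree at \<open>b\<close>.
\<close>

lemma (in wf_digraph) strongly_connected_imp_connected: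
  assumes "strongly_connected G"
  shows "connected G"
proof (rule connectedI)
  show "verts G \<noteq> {}"
    using assms by (simp add: strongly_connected_def)
  show "u \<rightarrow>\<^sup>*\<^bsub>mk_symmetric G\<^esub> v" if "u \<in> verts G" "v \<in> verts G" for u v
    using assms that by (intro reachable_mk_symmetricI) (simp add: strongly_connected_def)
qed

context fin_digraph
begin

lemma path_eulerian_iff_euler_trail:
  assumes "connected G"
  shows "path_eulerian \<longleftrightarrow> (\<exists>b p e. euler_trail b p e \<and> b \<noteq> e)"
  by (simp add: path_eulerian_def eulerian_dipath_def euler_trail_conv_connected[OF assms])

text \<open>
  A dicircuit is nonempty by definition, whereas the empty list is a closed trail; the presence of
  an arc removes this difference.
\<close>
lemma circuit_eulerian_iff_euler_trail:
  assumes "connected G" "arcs G \<noteq> {}"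
  shows "circuit_eulerian \<longleftrightarrow> (\<exists>u p. euler_trail u p u)"
proof -
  have "eulerian_dicircuit u p \<longleftrightarrow> euler_trail u p u" for u p
    using assms(2)
    by (auto simp: eulerian_dicircuit_def dicircuit_def trail_def
        euler_trail_conv_connected[OF assms(1)])
  then show ?thesis
    by (simp add: circuit_eulerian_def)
qed

lemma path_eulerian_iff_degrees:
  assumes "connected G"
  shows "path_eulerian \<longleftrightarrow> (\<exists>b \<in> verts G. \<exists>e \<in> verts G.
    (\<forall>x \<in> verts G. b \<noteq> x \<longrightarrow> e \<noteq> x \<longrightarrow> in_degree G x = out_degree G x) \<and>
    in_degree G b + 1 = out_degree G b \<and> out_degree G e + 1 = in_degree G e)"
  unfolding path_eulerian_iff_euler_trail[OF assms] open_euler using assms by blast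

lemma circuit_eulerian_iff_degrees:
  assumes "connected G" "arcs G \<noteq> {}"
  shows "circuit_eulerian \<longleftrightarrow> (\<forall>x \<in> verts G. in_degree G x = out_degree G x)"
  unfolding circuit_eulerian_iff_euler_trail[OF assms] closed_euler using assms by blast

lemma path_eulerian_imp_not_circuit_eulerian:
  assumes "connected G" "arcs G \<noteq> {}" "path_eulerian"
  shows "\<not> circuit_eulerian"
  using assms(3) unfolding path_eulerian_iff_degrees[OF assms(1)]
    circuit_eulerian_iff_degrees[OF assms(1,2)] by force

end

theorem corollary6:
  fixes G :: "('a, 'b) pre_digraph"
  assumes "fin_digraph G"
    and "verts G \<noteq> {}"
    and "arcs G \<noteq> {}"
    and "pre_digraph.dicircuit_connected G"
  shows "(pre_digraph.path_eulerian G \<and> \<not> pre_digraph.circuit_eulerian G) \<longleftrightarrow>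
    (\<exists>b \<in> verts G. \<exists>e \<in> verts G. b \<noteq> e \<and>
      int (out_degree G b) - int (in_degree G b) = 1 \<and>
      1 = int (in_degree G e) - int (out_degree G e) \<and>
      (\<forall>x \<in> verts G - {b, e}. out_degree G x = in_degree G x))"
    (is "_ \<longleftrightarrow> (\<exists>b \<in> _. \<exists>e \<in> _. ?degrees b e)")
proof -
  interpret fin_digraph G by fact
  have con: "connected G"
    using assms by (simp add: strongly_connected_imp_connected
        strongly_connected_iff_dicircuit_connected)
  have degrees: "?degrees b e \<longleftrightarrow>
      (\<forall>x \<in> verts G. b \<noteq> x \<longrightarrow> e \<noteq> x \<longrightarrow> in_degree G x = out_degree G x) \<and>
      in_degree G b + 1 = out_degree G b \<and> out_degree G e + 1 = in_degree G e" for b e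
    \<comment> \<open>The two imbalances have opposite signs, which already makes \<open>b\<close> and \<open>e\<close> distinct.\<close>
    by auto
  show ?thesis
    unfolding degrees path_eulerian_iff_degrees[OF con, symmetric]
    using path_eulerian_imp_not_circuit_eulerian[OF con assms(3)] by blast
qed

end
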